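(* Let $\mathcal{X}$ be a separable metric space, $k$ a bounded, continuous kernel on $\mathcal{X}$, and $P$ a Borel probability measure on $\mathcal{X}$. Let $P_n$ be the empirical measure formed by i.i.d. observations $X_1,\dots,X_n$ from $P$, and let $\widetilde{P}_n$ be an approximation of $P_n$. If $\mathbb{P}\big(\widetilde{P}_n\xrightarrow{w}P\big)=1$, then $$\sup_{x\in\mathcal{X}}\left|\Phi_k\widetilde{P}_n(x)-\Phi_kP(x)\right|\xrightarrow{a.s.}0\quad\text{as }n\to\infty.$$
   Context: Here $\widetilde{P}_n$ is a random Borel probability measure on $\mathcal{X}$, namely the empirical measure $n^{-1}\sum_{i=1}^n\delta_{\widetilde{X}_i}$ of $\mathcal{X}$-valued random elements $\widetilde{X}_1,\dots,\widetilde{X}_n$ that are reconstructions (approximations) of $X_1,\dots,X_n$; no independence or other property of the reconstructions is assumed beyond the stated weak convergence, and they may depend on $n$. $\xrightarrow{w}$ denotes weak convergence of probability measures. A kernel on a set $\mathcal{X}$ is a symmetric function $k\colon\mathcal{X}\times\mathcal{X}\to\mathbb{R}$ that is positive definite, i.e. $\sum_{i,j=1}^{n}a_ia_jk(x_i,x_j)\ge 0$ for all $n$, $a_i\in\mathbb{R}$, $x_i\in\mathcal{X}$; $\mathcal{H}_k$ denotes its reproducing kernel Hilbert space. For a bounded measurable kernel $k$ and a Borel probability measure $Q$ on $\mathcal{X}$, the kernel mean embedding is $\Phi_kQ=\int_{\mathcal{X}}k(\cdot,y)\,dQ(y)\in\mathcal{H}_k$ (Bochner integral), so $\Phi_kQ(x)=\int_{\mathcal{X}}k(x,y)\,dQ(y)$.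 *)

theory Defs
  imports "HOL-Probability.Probability"
begin

definition pd_kernel :: "('a \<Rightarrow> 'a \<Rightarrow> real) \<Rightarrow> bool" where
  "pd_kernel k \<longleftrightarrow> (\<forall>x y. k x y = k y x) \<and>
    (\<forall>(n::nat) (a::nat \<Rightarrow> real) (x::nat \<Rightarrow> 'a).
      0 \<le> (\<Sum>i<n. \<Sum>j<n. a i * a j * k (x i) (x j)))"

(* Hilbert spaces of functions are given by a carrier H and an inner product ip that is only
   meaningful on H. *)

definition hnorm :: "(('a \<Rightarrow> real) \<Rightarrow> ('a \<Rightarrow> real) \<Rightarrow> real) \<Rightarrow> ('a \<Rightarrow> real) \<Rightarrow> real" where
  "hnorm ip f = sqrt (ip f f)"

locale hilbert_function_space =
  fixes H :: "('a \<Rightarrow> real) set"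
    and ip :: "('a \<Rightarrow> real) \<Rightarrow> ('a \<Rightarrow> real) \<Rightarrow> real"
  assumes zero_mem: "(\<lambda>x. 0) \<in> H"
    and add_mem: "f \<in> H \<Longrightarrow> g \<in> H \<Longrightarrow> (\<lambda>x. f x + g x) \<in> H"
    and scale_mem: "f \<in> H \<Longrightarrow> (\<lambda>x. c * f x) \<in> H"
    and ip_commute: "f \<in> H \<Longrightarrow> g \<in> H \<Longrightarrow> ip f g = ip g f"
    and ip_add_left: "f \<in> H \<Longrightarrow> g \<in> H \<Longrightarrow> h \<in> H \<Longrightarrow> ip (\<lambda>x. f x + g x) h = ip f h + ip g h"
    and ip_scale_left: "f \<in> H \<Longrightarrow> g \<in> H \<Longrightarrow> ip (\<lambda>x. c * f x) g = c * ip f g"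
    and ip_nonneg: "f \<in> H \<Longrightarrow> 0 \<le> ip f f"
    and ip_eq_zero: "f \<in> H \<Longrightarrow> ip f f = 0 \<Longrightarrow> f = (\<lambda>x. 0)"
    and complete: "(\<And>n. s n \<in> H) \<Longrightarrow>
      (\<And>e. 0 < e \<Longrightarrow> \<exists>N. \<forall>m\<ge>N. \<forall>n\<ge>N. hnorm ip (\<lambda>x. s m x - s n x) < e) \<Longrightarrow>
      \<exists>f\<in>H. (\<lambda>n::nat. hnorm ip (\<lambda>x. s n x - f x)) \<longlonglongrightarrow> 0"

(* By the Moore-Aronszajn theorem, every kernel k has exactly one RKHS
   (H is unique, and ip is unique on H). *)
locale rkhs = hilbert_function_space H ip
  for k :: "'a \<Rightarrow> 'a \<Rightarrow> real"
    and H :: "('a \<Rightarrow> real) set"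
    and ip :: "('a \<Rightarrow> real) \<Rightarrow> ('a \<Rightarrow> real) \<Rightarrow> real" +
  assumes section_mem: "(\<lambda>x. k x y) \<in> H"
    and reproducing: "f \<in> H \<Longrightarrow> ip f (\<lambda>x. k x y) = f y"

(* The Bochner integral of the library needs the Banach space to be a type. The next two
   definitions follow simple_bochner_integral and has_bochner_integral, for H-valued
   functions and a finite measure Q. *)

definition simple_integral_in :: "'b measure \<Rightarrow> ('b \<Rightarrow> 'a \<Rightarrow> real) \<Rightarrow> 'a \<Rightarrow> real" where
  "simple_integral_in Q s =
    (\<lambda>x. \<Sum>h\<in>s ` space Q. measure Q {y \<in> space Q. s y = h} * h x)"

(* The measurability conjunct matters: without it, the nn_integral below would only be
   a lower integral. *)
definition has_bochner_integral_in ::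
  "('a \<Rightarrow> real) set \<Rightarrow> (('a \<Rightarrow> real) \<Rightarrow> ('a \<Rightarrow> real) \<Rightarrow> real) \<Rightarrow>
    'b measure \<Rightarrow> ('b \<Rightarrow> 'a \<Rightarrow> real) \<Rightarrow> ('a \<Rightarrow> real) \<Rightarrow> bool" where
  "has_bochner_integral_in H ip Q f v \<longleftrightarrow>
    v \<in> H \<and> (\<forall>y\<in>space Q. f y \<in> H) \<and>
    (\<exists>s :: nat \<Rightarrow> 'b \<Rightarrow> 'a \<Rightarrow> real.
      (\<forall>i. simple_function Q (s i) \<and> s i ` space Q \<subseteq> H \<and>
        (\<lambda>y. hnorm ip (\<lambda>x. f y x - s i y x)) \<in> borel_measurable Q) \<and>
      (\<lambda>i. \<integral>\<^sup>+ y. ennreal (hnorm ip (\<lambda>x. f y x - s i y x)) \<partial>Q) \<longlonglongrightarrow> 0 \<and>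
      (\<lambda>i. hnorm ip (\<lambda>x. simple_integral_in Q (s i) x - v x)) \<longlonglongrightarrow> 0)"

definition kernel_mean_embedding ::
  "('a \<Rightarrow> real) set \<Rightarrow> (('a \<Rightarrow> real) \<Rightarrow> ('a \<Rightarrow> real) \<Rightarrow> real) \<Rightarrow>
    ('a \<Rightarrow> 'a \<Rightarrow> real) \<Rightarrow> 'a measure \<Rightarrow> 'a \<Rightarrow> real" where
  "kernel_mean_embedding H ip k Q =
    (THE v. has_bochner_integral_in H ip Q (\<lambda>y x. k x y) v)"

definition empirical_measure :: "nat \<Rightarrow> (nat \<Rightarrow> 'a::topological_space) \<Rightarrow> 'a measure" where
  "empirical_measure n x = measure_of UNIV (sets borel)
    (\<lambda>A. (\<Sum>i=1..n. emeasure (return borel (x i)) A) / of_nat n)"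

definition weak_conv_to ::
  "(nat \<Rightarrow> 'a::topological_space measure) \<Rightarrow> 'a measure \<Rightarrow> bool" where
  "weak_conv_to Q P \<longleftrightarrow>
    (\<forall>f :: 'a \<Rightarrow> real. continuous_on UNIV f \<longrightarrow> bounded (range f) \<longrightarrow>
      (\<lambda>n. \<integral>x. f x \<partial>Q n) \<longlonglongrightarrow> (\<integral>x. f x \<partial>P))"

lemma sets_empirical_measure [simp, measurable_cong]:
  "sets (empirical_measure n x) = sets borel"
  unfolding empirical_measure_def by (metis sets.sets_measure_of_eq space_borel)

lemma space_empirical_measure [simp]: "space (empirical_measure n x) = UNIV"
  by (simp add: empirical_measure_def space_measure_of_conv)

lemma emeasure_empirical_measure:
  assumes "A \<in> sets borel"
  shows "emeasure (empirical_measure n x) A =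
    (\<Sum>i=1..n. emeasure (return borel (x i)) A) / of_nat n"
proof (rule emeasure_measure_of[OF empirical_measure_def])
  show "countably_additive (sets (empirical_measure n x))
      (\<lambda>A. (\<Sum>i=1..n. emeasure (return borel (x i)) A) / of_nat n)"
    unfolding countably_additive_def
  proof (intro allI impI)
    fix A :: "nat \<Rightarrow> 'a set"
    assume A: "range A \<subseteq> sets (empirical_measure n x)" "disjoint_family A"
    have "(\<Sum>j. (\<Sum>i=1..n. emeasure (return borel (x i)) (A j)) / of_nat n)
        = (\<Sum>j. \<Sum>i=1..n. emeasure (return borel (x i)) (A j)) / of_nat n"
      by simp
    also have "(\<Sum>j. \<Sum>i=1..n. emeasure (return borel (x i)) (A j))
        = (\<Sum>i=1..n. \<Sum>j. emeasure (return borel (x i)) (A j))"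
      by (rule suminf_sum) simp
    also have "\<dots> = (\<Sum>i=1..n. emeasure (return borel (x i)) (\<Union>j. A j))"
      using A by (intro sum.cong refl suminf_emeasure) auto
    finally show "(\<Sum>j. (\<Sum>i=1..n. emeasure (return borel (x i)) (A j)) / of_nat n)
        = (\<Sum>i=1..n. emeasure (return borel (x i)) (\<Union>j. A j)) / of_nat n" .
  qed
qed (use assms in \<open>auto simp: positive_def\<close>)

end

theory Submission
  imports Defs
begin

text \<open>Rounding points to a countable dense set shows that the mean embedding exists as a Bochner
  integral in the RKHS, and the reproducing property then evaluates it pointwise as
  \<open>\<integral> k x y dQ(y)\<close>. The functions \<open>k x\<close> are bounded and, again by the reproducing property,
  equicontinuous, so along every outcome for which the reconstructed measures converge weakly
  their integrals converge uniformly in \<open>x\<close>.\<close>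

text \<open>The mean embedding is a definite description, so nothing can be said about it until a
  Bochner integral is known to exist and to be unique. Pointwise evaluation settles uniqueness: it
  forces every candidate value to be the same function. Since H is a carrier set and not a type, the
  inner product geometry and the estimates for integrals of simple functions are derived relative to
  H. Separability enters twice: through the dense sequence used for rounding, and through a
  countable subcover by balls, which lets finitely many balls carry most of the mass of
  \<open>P\<close>.\<close>

section \<open>Inner product geometry relative to a carrier set\<close>

context hilbert_function_space
begin

lemma diff_mem: "f \<in> H \<Longrightarrow> g \<in> H \<Longrightarrow> (\<lambda>x. f x - g x) \<in> H"
  using add_mem[of f "\<lambda>x. (-1) * g x"] scale_mem[of g "-1"] by simp

lemma sum_mem:
  assumes "finite A" "\<And>a. a \<in> A \<Longrightarrow> h a \<in> H"
  shows "(\<lambda>x. \<Sum>a\<in>A. c a * h a x) \<in> H"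
  using assms by (induction A) (auto intro!: zero_mem add_mem scale_mem)

lemma ip_zero_left: "g \<in> H \<Longrightarrow> ip (\<lambda>x. 0) g = 0"
  using ip_scale_left[OF zero_mem, of g 0] by simp

lemma ip_diff_left:
  assumes "f \<in> H" "g \<in> H" "h \<in> H"
  shows "ip (\<lambda>x. f x - g x) h = ip f h - ip g h"
  using ip_add_left[of f "\<lambda>x. (-1) * g x" h] ip_scale_left[of g h "-1"] scale_mem[of g "-1"] assms
  by simp

lemma ip_sum_left:
  assumes "finite A" "\<And>a. a \<in> A \<Longrightarrow> h a \<in> H" "g \<in> H"
  shows "ip (\<lambda>x. \<Sum>a\<in>A. c a * h a x) g = (\<Sum>a\<in>A. c a * ip (h a) g)"
  using assms
proof (induction A)
  case (insert a A)
  then have "(\<lambda>x. c a * h a x) \<in> H" "(\<lambda>x. \<Sum>a\<in>A. c a * h a x) \<in> H"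
    by (auto intro!: scale_mem sum_mem)
  with insert show ?case by (simp add: ip_add_left ip_scale_left)
qed (simp add: ip_zero_left)

lemma hnorm_nonneg: "f \<in> H \<Longrightarrow> 0 \<le> hnorm ip f"
  by (simp add: hnorm_def ip_nonneg)

lemma hnorm_square: "f \<in> H \<Longrightarrow> (hnorm ip f)\<^sup>2 = ip f f"
  by (simp add: hnorm_def ip_nonneg)

lemma ip_diff_diff:
  assumes f: "f \<in> H" and g: "g \<in> H"
  shows "ip (\<lambda>x. f x - g x) (\<lambda>x. f x - g x) = ip f f - 2 * ip f g + ip g g"
proof -
  have "ip (\<lambda>x. f x - g x) (\<lambda>x. f x - g x)
      = ip (\<lambda>x. f x - g x) f - ip (\<lambda>x. f x - g x) g"
    using ip_diff_left[OF f g diff_mem[OF f g]] ip_commute[OF f diff_mem[OF f g]]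
      ip_commute[OF g diff_mem[OF f g]] by simp
  then show ?thesis
    using ip_diff_left[OF f g f] ip_diff_left[OF f g g] ip_commute[OF f g] by simp
qed

lemma Cauchy_Schwarz:
  assumes f: "f \<in> H" and g: "g \<in> H"
  shows "\<bar>ip f g\<bar> \<le> hnorm ip f * hnorm ip g"
proof (cases "ip g g = 0")
  case True
  then have "g = (\<lambda>x. 0)" by (rule ip_eq_zero[OF g])
  then show ?thesis
    using ip_zero_left[OF f] ip_commute[OF f g] hnorm_nonneg[OF f] hnorm_nonneg[OF g] by simp
next
  case False
  with ip_nonneg[OF g] have pos: "0 < ip g g" by simp
  \<comment> \<open>The projection coefficient of f on g, which minimises the norm of f - t g;
    nonnegativity of that minimum is the inequality.\<close>
  define t where "t = ip f g / ip g g"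
  have tg: "(\<lambda>x. t * g x) \<in> H" by (rule scale_mem[OF g])
  have "0 \<le> ip f f - 2 * ip f (\<lambda>x. t * g x) + ip (\<lambda>x. t * g x) (\<lambda>x. t * g x)"
    using ip_nonneg[OF diff_mem[OF f tg]] ip_diff_diff[OF f tg] by simp
  also have "\<dots> = ip f f - 2 * (t * ip f g) + t * (t * ip g g)"
    using ip_commute[OF f tg] ip_commute[OF g tg] ip_commute[OF f g]
      ip_scale_left[OF g f] ip_scale_left[OF g tg] ip_scale_left[OF g g] by simp
  also have "\<dots> = ip f f - (ip f g)\<^sup>2 / ip g g"
    using pos by (simp add: t_def power2_eq_square)
  finally have "(ip f g)\<^sup>2 \<le> ip f f * ip g g"
    using pos by (simp add: field_simps)
  then have "\<bar>ip f g\<bar>\<^sup>2 \<le> (hnorm ip f * hnorm ip g)\<^sup>2"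
    by (simp add: power_mult_distrib hnorm_square f g)
  then show ?thesis
    by (rule power2_le_imp_le) (simp add: hnorm_nonneg f g)
qed

lemma hnorm_minus_commute:
  assumes "f \<in> H" "g \<in> H"
  shows "hnorm ip (\<lambda>x. f x - g x) = hnorm ip (\<lambda>x. g x - f x)"
  using assms by (simp add: hnorm_def ip_diff_diff ip_commute)

text \<open>Split only one factor of the squared norm of f - h. Cauchy-Schwarz then leaves the norm
  of f - h as a common factor, which cancels unless it is zero.\<close>

lemma hnorm_triangle:
  assumes f: "f \<in> H" and g: "g \<in> H" and h: "h \<in> H"
  shows "hnorm ip (\<lambda>x. f x - h x) \<le> hnorm ip (\<lambda>x. f x - g x) + hnorm ip (\<lambda>x. g x - h x)"
proof -
  let ?a = "\<lambda>x. f x - g x" and ?b = "\<lambda>x. g x - h x" and ?c = "\<lambda>x. f x - h x"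
  have mem: "?a \<in> H" "?b \<in> H" "?c \<in> H" using f g h by (auto intro: diff_mem)
  have "(hnorm ip ?c)\<^sup>2 = ip ?a ?c + ip ?b ?c"
    using ip_add_left[OF mem] mem by (simp add: hnorm_square)
  also have "\<dots> \<le> hnorm ip ?a * hnorm ip ?c + hnorm ip ?b * hnorm ip ?c"
    using Cauchy_Schwarz[OF mem(1,3)] Cauchy_Schwarz[OF mem(2,3)] by linarith
  finally have "hnorm ip ?c * hnorm ip ?c \<le> (hnorm ip ?a + hnorm ip ?b) * hnorm ip ?c"
    by (simp add: power2_eq_square algebra_simps)
  then show ?thesis
    using hnorm_nonneg[OF mem(1)] hnorm_nonneg[OF mem(2)] hnorm_nonneg[OF mem(3)]
    by (cases "hnorm ip ?c = 0") (auto simp: mult_le_cancel_right)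
qed

end

section \<open>Integrals of simple functions and completeness\<close>

text \<open>A function with finitely many values stays simple under an arbitrary
  \<open>\<phi>\<close>. This matters because \<open>\<phi>\<close> will be an inner product or a
  norm on H, where no sigma-algebra has been fixed.\<close>

lemma integrable_simple_compose:
  fixes \<phi> :: "'b \<Rightarrow> real"
  assumes "finite_measure Q" "simple_function Q s"
  shows "integrable Q (\<lambda>y. \<phi> (s y))"
  using assms
  by (intro integrable_simple_function simple_function_compose1[of Q s \<phi>])
    (auto simp: finite_measure.emeasure_finite less_top)

text \<open>The bridge from the finite sums of \<open>simple_integral_in\<close> to scalar
  integrals, where the calculus of real integrals applies.\<close>

lemma integral_simple_compose:
  fixes \<phi> :: "'b \<Rightarrow> real"
  assumes "finite_measure Q" and s: "simple_function Q s"
  shows "(\<integral>y. \<phi> (s y) \<partial>Q) = (\<Sum>h\<in>s ` space Q. measure Q {y \<in> space Q. s y = h} * \<phi> h)"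
proof -
  interpret finite_measure Q by fact
  have fin: "finite (s ` space Q)" using s by (simp add: simple_function_def)
  have meas: "{y \<in> space Q. s y = h} \<in> sets Q" for h
    using simple_functionD(2)[OF s, of "{h}"] by (simp add: vimage_def Int_def conj_commute)
  have "(\<integral>y. \<phi> (s y) \<partial>Q)
      = (\<integral>y. (\<Sum>h\<in>s ` space Q. indicator {y \<in> space Q. s y = h} y * \<phi> h) \<partial>Q)"
  proof (rule Bochner_Integration.integral_cong)
    fix y assume y: "y \<in> space Q"
    have "(\<Sum>h\<in>s ` space Q. indicator {y \<in> space Q. s y = h} y * \<phi> h)
        = (\<Sum>h\<in>s ` space Q. if s y = h then \<phi> h else 0)"
      using y by (intro sum.cong) (auto simp: indicator_def)
    then show "\<phi> (s y) = (\<Sum>h\<in>s ` space Q. indicator {y \<in> space Q. s y = h} y * \<phi> h)"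
      using y fin by simp
  qed simp
  also have "\<dots> = (\<Sum>h\<in>s ` space Q. measure Q {y \<in> space Q. s y = h} * \<phi> h)"
    using meas by (subst Bochner_Integration.integral_sum) (auto simp: emeasure_eq_measure Int_absorb2)
  finally show ?thesis .
qed

lemma simple_integral_in_eq:
  assumes "finite_measure Q" "simple_function Q s"
  shows "simple_integral_in Q s x = (\<integral>y. s y x \<partial>Q)"
  using integral_simple_compose[OF assms, of "\<lambda>h. h x"] by (simp add: simple_integral_in_def)

context hilbert_function_space
begin

lemma simple_integral_in_mem:
  assumes "simple_function Q s" "s ` space Q \<subseteq> H"
  shows "simple_integral_in Q s \<in> H"
  unfolding simple_integral_in_def using assms
  by (intro sum_mem) (auto simp: simple_function_def)

lemma ip_simple_integral_in:
  assumes "finite_measure Q" "simple_function Q s" "s ` space Q \<subseteq> H" "g \<in> H"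
  shows "ip (simple_integral_in Q s) g = (\<integral>y. ip (s y) g \<partial>Q)"
  unfolding simple_integral_in_def integral_simple_compose[OF assms(1,2), of "\<lambda>h. ip h g"]
  using assms by (intro ip_sum_left) (auto simp: simple_function_def)

text \<open>Pair the difference of the integrals with itself, move the inner product under the
  integral and apply Cauchy-Schwarz pointwise; one factor of the norm cancels.\<close>

lemma hnorm_simple_integral_in_diff_le:
  assumes Q: "finite_measure Q"
    and s: "simple_function Q s" "s ` space Q \<subseteq> H"
    and t: "simple_function Q t" "t ` space Q \<subseteq> H"
  shows "hnorm ip (\<lambda>x. simple_integral_in Q s x - simple_integral_in Q t x)
    \<le> (\<integral>y. hnorm ip (\<lambda>x. s y x - t y x) \<partial>Q)" (is "hnorm ip ?D \<le> ?I")
proof -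
  have mem: "simple_integral_in Q s \<in> H" "simple_integral_in Q t \<in> H"
    using s t by (auto intro: simple_integral_in_mem)
  then have D: "?D \<in> H" by (rule diff_mem)
  \<comment> \<open>Pairing acts as a common refinement: the distance of \<open>s y\<close> and
    \<open>t y\<close> becomes a function of one simple function.\<close>
  have st: "simple_function Q (\<lambda>y. (s y, t y))" using s(1) t(1) by (rule simple_function_Pair)
  have int: "integrable Q (\<lambda>y. hnorm ip (\<lambda>x. s y x - t y x))"
    using integrable_simple_compose[OF Q st, of "\<lambda>(f, g). hnorm ip (\<lambda>x. f x - g x)"] by simp
  have int2: "integrable Q (\<lambda>y. ip (s y) ?D)" "integrable Q (\<lambda>y. ip (t y) ?D)"
    using integrable_simple_compose[OF Q s(1), of "\<lambda>f. ip f ?D"]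
      integrable_simple_compose[OF Q t(1), of "\<lambda>f. ip f ?D"] by auto
  have "(hnorm ip ?D)\<^sup>2 = ip (simple_integral_in Q s) ?D - ip (simple_integral_in Q t) ?D"
    using D mem by (simp add: hnorm_square ip_diff_left)
  also have "\<dots> = (\<integral>y. ip (s y) ?D - ip (t y) ?D \<partial>Q)"
    using ip_simple_integral_in[OF Q s D] ip_simple_integral_in[OF Q t D] int2 by simp
  also have "\<dots> \<le> (\<integral>y. hnorm ip (\<lambda>x. s y x - t y x) * hnorm ip ?D \<partial>Q)"
  proof (rule integral_mono)
    fix y assume "y \<in> space Q"
    then have y: "s y \<in> H" "t y \<in> H" using s t by auto
    show "ip (s y) ?D - ip (t y) ?D \<le> hnorm ip (\<lambda>x. s y x - t y x) * hnorm ip ?D"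
      using Cauchy_Schwarz[OF diff_mem[OF y] D] ip_diff_left[OF y D] by linarith
  qed (use int int2 in auto)
  also have "\<dots> = ?I * hnorm ip ?D" by simp
  finally have le: "hnorm ip ?D * hnorm ip ?D \<le> ?I * hnorm ip ?D" by (simp add: power2_eq_square)
  have "0 \<le> ?I"
    using s t by (intro Bochner_Integration.integral_nonneg_AE AE_I2 hnorm_nonneg diff_mem) auto
  with le show ?thesis
    using hnorm_nonneg[OF D] by (cases "hnorm ip ?D = 0") (auto simp: mult_le_cancel_right)
qed

text \<open>Two approximating integrals differ in norm by at most the sum of their L1 errors, so
  they form a Cauchy sequence and completeness of H supplies the value.\<close>

lemma bochner_integral_in_exists:
  assumes Q: "finite_measure Q"
    and f: "\<And>y. y \<in> space Q \<Longrightarrow> f y \<in> H"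
    and s: "\<And>i. simple_function Q (s i)" "\<And>i. s i ` space Q \<subseteq> H"
    and meas: "\<And>i. (\<lambda>y. hnorm ip (\<lambda>x. f y x - s i y x)) \<in> borel_measurable Q"
    and lim: "(\<lambda>i. \<integral>\<^sup>+ y. ennreal (hnorm ip (\<lambda>x. f y x - s i y x)) \<partial>Q) \<longlonglongrightarrow> 0"
  shows "\<exists>v. has_bochner_integral_in H ip Q f v"
proof -
  let ?I = "\<lambda>i. simple_integral_in Q (s i)"
  let ?a = "\<lambda>i. \<integral>\<^sup>+ y. ennreal (hnorm ip (\<lambda>x. f y x - s i y x)) \<partial>Q"
  have mem: "?I i \<in> H" for i using s by (intro simple_integral_in_mem)
  have sH: "s i y \<in> H" if "y \<in> space Q" for i y using s(2)[of i] that by auto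
  have le: "ennreal (hnorm ip (\<lambda>x. ?I i x - ?I j x)) \<le> ?a i + ?a j" for i j
  proof -
    have st: "simple_function Q (\<lambda>y. (s i y, s j y))" using s(1) s(1) by (rule simple_function_Pair)
    have int: "integrable Q (\<lambda>y. hnorm ip (\<lambda>x. s i y x - s j y x))"
      using integrable_simple_compose[OF Q st, of "\<lambda>(f, g). hnorm ip (\<lambda>x. f x - g x)"] by simp
    have "ennreal (hnorm ip (\<lambda>x. ?I i x - ?I j x))
        \<le> ennreal (\<integral>y. hnorm ip (\<lambda>x. s i y x - s j y x) \<partial>Q)"
      by (rule ennreal_leI, rule hnorm_simple_integral_in_diff_le) (use Q s in auto)
    also have "\<dots> = (\<integral>\<^sup>+y. ennreal (hnorm ip (\<lambda>x. s i y x - s j y x)) \<partial>Q)"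
      using int by (intro nn_integral_eq_integral[symmetric])
        (auto intro!: AE_I2 hnorm_nonneg diff_mem sH)
    also have "\<dots> \<le> (\<integral>\<^sup>+y. ennreal (hnorm ip (\<lambda>x. f y x - s i y x))
        + ennreal (hnorm ip (\<lambda>x. f y x - s j y x)) \<partial>Q)"
    proof (rule nn_integral_mono)
      fix y assume y: "y \<in> space Q"
      have "hnorm ip (\<lambda>x. s i y x - s j y x)
          \<le> hnorm ip (\<lambda>x. f y x - s i y x) + hnorm ip (\<lambda>x. f y x - s j y x)"
        using hnorm_triangle[OF sH[OF y, of i] f[OF y] sH[OF y, of j]]
          hnorm_minus_commute[OF sH[OF y, of i] f[OF y]] by simp
      then show "ennreal (hnorm ip (\<lambda>x. s i y x - s j y x))
          \<le> ennreal (hnorm ip (\<lambda>x. f y x - s i y x)) + ennreal (hnorm ip (\<lambda>x. f y x - s j y x))"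
        using y by (subst ennreal_plus[symmetric])
          (auto intro!: ennreal_leI hnorm_nonneg diff_mem sH f)
    qed
    also have "\<dots> = ?a i + ?a j"
      using meas by (intro nn_integral_add) auto
    finally show ?thesis .
  qed
  have "\<exists>v\<in>H. (\<lambda>n. hnorm ip (\<lambda>x. ?I n x - v x)) \<longlonglongrightarrow> 0"
  proof (rule complete[OF mem])
    fix e :: real assume e: "0 < e"
    then have "0 < ennreal (e / 2)" by simp
    then have "\<forall>\<^sub>F i in sequentially. ?a i < ennreal (e / 2)"
      using order_tendstoD(2)[OF lim] by blast
    then obtain N where N: "\<And>i. i \<ge> N \<Longrightarrow> ?a i < ennreal (e / 2)"
      by (auto simp: eventually_sequentially)
    show "\<exists>N. \<forall>m\<ge>N. \<forall>n\<ge>N. hnorm ip (\<lambda>x. ?I m x - ?I n x) < e"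
    proof (intro exI allI impI)
      fix m n assume "N \<le> m" "N \<le> n"
      then have "ennreal (hnorm ip (\<lambda>x. ?I m x - ?I n x)) < ennreal (e / 2) + ennreal (e / 2)"
        using le[of m n] add_strict_mono[OF N[of m] N[of n]] by (auto intro: le_less_trans)
      also have "\<dots> = ennreal e" using e by (subst ennreal_plus[symmetric]) auto
      finally show "hnorm ip (\<lambda>x. ?I m x - ?I n x) < e"
        by (subst (asm) ennreal_less_iff) (auto intro: hnorm_nonneg diff_mem mem)
    qed
  qed
  then show ?thesis
    unfolding has_bochner_integral_in_def using f s meas lim by blast
qed

end

section \<open>Point evaluation and the kernel distance\<close>

context rkhs
begin

lemma kernel_nonneg: "0 \<le> k x x"
  using ip_nonneg[OF section_mem[of x]] reproducing[OF section_mem[of x], of x] by simp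

text \<open>Evaluation at x is the inner product with the section at x, whose norm is
  \<open>sqrt (k x x)\<close>. Norm convergence in H thereby implies pointwise convergence.\<close>

lemma abs_eval_le:
  assumes "f \<in> H"
  shows "\<bar>f x\<bar> \<le> sqrt (k x x) * hnorm ip f"
  using Cauchy_Schwarz[OF assms section_mem[of x]] reproducing[OF assms, of x]
    reproducing[OF section_mem[of x], of x]
  by (simp add: hnorm_def mult.commute)

text \<open>The kernel distance of two points, written through k alone, so that continuity and
  boundedness of k carry over to it.\<close>

lemma hnorm_section_diff:
  "hnorm ip (\<lambda>x. k x y - k x z) = sqrt (k y y - 2 * k z y + k z z)"
  unfolding hnorm_def ip_diff_diff[OF section_mem section_mem] reproducing[OF section_mem] ..

text \<open>Evaluation at x is a bounded linear functional on H and so commutes with the integral: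
  both sides are limits of the scalar integrals of the simple approximants. Applied at every x, it
  determines v.\<close>

lemma has_bochner_integral_in_eval:
  assumes Q: "finite_measure Q"
    and v: "has_bochner_integral_in H ip Q f v"
    and int: "integrable Q (\<lambda>y. f y x)"
  shows "v x = (\<integral>y. f y x \<partial>Q)"
proof -
  obtain s where v: "v \<in> H" and f: "\<And>y. y \<in> space Q \<Longrightarrow> f y \<in> H"
    and s: "\<And>i. simple_function Q (s i)" "\<And>i. s i ` space Q \<subseteq> H"
      "\<And>i. (\<lambda>y. hnorm ip (\<lambda>x. f y x - s i y x)) \<in> borel_measurable Q"
    and lim: "(\<lambda>i. \<integral>\<^sup>+ y. ennreal (hnorm ip (\<lambda>x. f y x - s i y x)) \<partial>Q) \<longlonglongrightarrow> 0"
      "(\<lambda>i. hnorm ip (\<lambda>x. simple_integral_in Q (s i) x - v x)) \<longlonglongrightarrow> 0"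
    using v unfolding has_bochner_integral_in_def by blast
  have sH: "s i y \<in> H" if "y \<in> space Q" for i y using s(2)[of i] that by auto
  have "(\<lambda>i. simple_integral_in Q (s i) x - v x) \<longlonglongrightarrow> 0"
  proof (rule Lim_null_comparison)
    show "\<forall>\<^sub>F i in sequentially. norm (simple_integral_in Q (s i) x - v x)
        \<le> sqrt (k x x) * hnorm ip (\<lambda>x. simple_integral_in Q (s i) x - v x)"
      using abs_eval_le[OF diff_mem[OF simple_integral_in_mem[OF s(1,2)] v]] by simp
    show "(\<lambda>i. sqrt (k x x) * hnorm ip (\<lambda>x. simple_integral_in Q (s i) x - v x)) \<longlonglongrightarrow> 0"
      using tendsto_mult_right_zero[OF lim(2)] .
  qed
  then have lim_v: "(\<lambda>i. simple_integral_in Q (s i) x) \<longlonglongrightarrow> v x" by (simp add: LIM_zero_iff)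
  \<comment> \<open>The L1 convergence in H passes to the scalar functions at x, because evaluation
    costs only the fixed factor \<open>sqrt (k x x)\<close>.\<close>
  have "(\<lambda>i. \<integral>y. s i y x \<partial>Q) \<longlonglongrightarrow> (\<integral>y. f y x \<partial>Q)"
  proof (rule tendsto_L1_int)
    show int_s: "integrable Q (\<lambda>y. s i y x)" for i
      using integrable_simple_compose[OF Q s(1), of "\<lambda>h. h x"] .
    have "(\<lambda>i. ennreal (sqrt (k x x)) * (\<integral>\<^sup>+ y. ennreal (hnorm ip (\<lambda>x. f y x - s i y x)) \<partial>Q))
        \<longlonglongrightarrow> ennreal (sqrt (k x x)) * 0"
      using lim(1) by (intro ennreal_tendsto_cmult) auto
    then have lim0: "(\<lambda>i. ennreal (sqrt (k x x))
        * (\<integral>\<^sup>+ y. ennreal (hnorm ip (\<lambda>x. f y x - s i y x)) \<partial>Q)) \<longlonglongrightarrow> 0" by simp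
    show "(\<lambda>i. \<integral>\<^sup>+ y. ennreal (norm (s i y x - f y x)) \<partial>Q) \<longlonglongrightarrow> 0"
    proof (rule tendsto_sandwich[OF _ _ tendsto_const lim0])
      show "\<forall>\<^sub>F i in sequentially. (\<integral>\<^sup>+ y. ennreal (norm (s i y x - f y x)) \<partial>Q)
          \<le> ennreal (sqrt (k x x)) * (\<integral>\<^sup>+ y. ennreal (hnorm ip (\<lambda>x. f y x - s i y x)) \<partial>Q)"
      proof (rule always_eventually, rule allI)
        fix i
        have "(\<integral>\<^sup>+ y. ennreal (norm (s i y x - f y x)) \<partial>Q)
            \<le> (\<integral>\<^sup>+ y. ennreal (sqrt (k x x)) * ennreal (hnorm ip (\<lambda>x. f y x - s i y x)) \<partial>Q)"
        proof (rule nn_integral_mono)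
          fix y assume y: "y \<in> space Q"
          show "ennreal (norm (s i y x - f y x))
              \<le> ennreal (sqrt (k x x)) * ennreal (hnorm ip (\<lambda>x. f y x - s i y x))"
            using abs_eval_le[OF diff_mem[OF f[OF y] sH[OF y, of i]], of x]
              hnorm_nonneg[OF diff_mem[OF f[OF y] sH[OF y, of i]]] kernel_nonneg[of x]
            by (simp add: abs_minus_commute ennreal_mult[symmetric] ennreal_leI)
        qed
        also have "\<dots> = ennreal (sqrt (k x x))
            * (\<integral>\<^sup>+ y. ennreal (hnorm ip (\<lambda>x. f y x - s i y x)) \<partial>Q)"
          using s(3) by (intro nn_integral_cmult) auto
        finally show "(\<integral>\<^sup>+ y. ennreal (norm (s i y x - f y x)) \<partial>Q) \<le> \<dots>" .
      qed
    qed simp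
  qed (rule int)
  then show ?thesis
    using lim_v by (simp add: simple_integral_in_eq[OF Q s(1)] LIMSEQ_unique)
qed

end

section \<open>Existence and pointwise form of the mean embedding\<close>

text \<open>Rounding to the first \<^term>\<open>i + 1\<close> points of a dense sequence yields the simple functions
  approximating the Bochner integral.\<close>

primrec nearest_index :: "('a \<Rightarrow> 'a \<Rightarrow> real) \<Rightarrow> (nat \<Rightarrow> 'a) \<Rightarrow> nat \<Rightarrow> 'a \<Rightarrow> nat" where
  "nearest_index r D 0 y = 0"
| "nearest_index r D (Suc i) y =
    (if r y (D (Suc i)) < r y (D (nearest_index r D i y)) then Suc i else nearest_index r D i y)"

lemma nearest_index_le: "nearest_index r D i y \<le> i"
  by (induction i) auto

lemma nearest_index_minimal: "j \<le> i \<Longrightarrow> r y (D (nearest_index r D i y)) \<le> r y (D j)"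
proof (induction i)
  case (Suc i)
  then show ?case by (cases "j = Suc i") fastforce+
qed simp

text \<open>The index takes countably many values, so the distance to the currently nearest point is
  measurable; each update is then a measurable case distinction.\<close>

lemma measurable_nearest_index:
  assumes r: "\<And>z. (\<lambda>y. r y z) \<in> borel_measurable Q"
  shows "nearest_index r D i \<in> measurable Q (count_space UNIV)"
proof (induction i)
  case (Suc i)
  have "(\<lambda>y. r y (D (nearest_index r D i y))) \<in> borel_measurable Q"
    by (rule measurable_compose_countable[OF r Suc])
  with Suc r show ?case by simp
qed simp

lemma continuous_on_sections:
  assumes "continuous_on UNIV (\<lambda>(x, y). k x y)"
  shows "continuous_on UNIV (\<lambda>y. k x y)" "continuous_on UNIV (\<lambda>y. k y x)"
    "continuous_on UNIV (\<lambda>y. k y y)"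
  using continuous_on_compose2[OF assms, of UNIV "\<lambda>y. (x, y)"]
    continuous_on_compose2[OF assms, of UNIV "\<lambda>y. (y, x)"]
    continuous_on_compose2[OF assms, of UNIV "\<lambda>y. (y, y)"]
  by (simp_all add: continuous_on_Pair continuous_on_id continuous_on_const)

lemma bochner_integral_in_kernel_exists:
  fixes k :: "'a::second_countable_topology \<Rightarrow> 'a \<Rightarrow> real"
  assumes rkhs: "rkhs k H ip"
    and bound: "\<And>x y. \<bar>k x y\<bar> \<le> B"
    and cont: "continuous_on UNIV (\<lambda>(x, y). k x y)"
    and Q: "finite_measure Q" and sets: "sets Q = sets borel"
  shows "\<exists>v. has_bochner_integral_in H ip Q (\<lambda>y x. k x y) v"
proof -
  interpret rkhs k H ip by fact
  interpret finite_measure Q by fact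
  \<comment> \<open>Rounding is governed by the kernel distance, because this is exactly the error
    that the Bochner integral measures.\<close>
  define r where "r y z = hnorm ip (\<lambda>x. k x y - k x z)" for y z
  have r_eq: "r y z = sqrt (k y y - 2 * k z y + k z z)" for y z
    unfolding r_def by (rule hnorm_section_diff)
  \<comment> \<open>Continuity in the first argument makes the rounding measurable; continuity in
    the second makes the \<open>r\<close>-balls open.\<close>
  have r_cont: "continuous_on UNIV (\<lambda>y. r y z)" "continuous_on UNIV (\<lambda>z. r y z)" for y z
    unfolding r_eq by (intro continuous_intros continuous_on_sections[OF cont])+
  have r_meas: "(\<lambda>y. r y z) \<in> borel_measurable Q" for z
    using borel_measurable_continuous_onI[OF r_cont(1)] sets measurable_cong_sets by blast
  have r_nonneg: "0 \<le> r y z" for y z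
    unfolding r_def by (intro hnorm_nonneg diff_mem section_mem)
  \<comment> \<open>Two diagonal terms and a doubled cross term, each bounded by B, give the
    constant that dominates all rounding errors.\<close>
  have r_bound: "r y z \<le> sqrt (4 * B)" for y z
    unfolding r_eq using bound[of y y] bound[of z y] bound[of z z]
    by (intro real_sqrt_le_mono) linarith
  obtain C :: "'a set" where C: "countable C" "\<And>U. open U \<Longrightarrow> U \<noteq> {} \<Longrightarrow> \<exists>d\<in>C. d \<in> U"
    using countable_dense_exists by blast
  have "C \<noteq> {}" using C(2)[of UNIV] by auto
  define D where "D = from_nat_into C"
  have D: "range D = C" unfolding D_def by (rule range_from_nat_into) fact+
  define p where "p = nearest_index r D"
  define s where "s i y = (\<lambda>x. k x (D (p i y)))" for i y
  have p_meas: "p i \<in> measurable Q (count_space UNIV)" for i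
    unfolding p_def by (rule measurable_nearest_index[OF r_meas])
  have p_simple: "simple_function Q (p i)" for i
    unfolding simple_function_def
  proof (intro conjI ballI)
    show "finite (p i ` space Q)"
      by (rule finite_subset[of _ "{..i}"]) (auto simp: p_def nearest_index_le)
    show "p i -` {x} \<inter> space Q \<in> sets Q" for x
      using measurable_sets[OF p_meas, of "{x}" i] by simp
  qed
  have norm_eq: "hnorm ip (\<lambda>x. k x y - s i y x) = r y (D (p i y))" for i y
    by (simp add: r_def s_def)
  have r_lim: "(\<lambda>i. r y (D (p i y))) \<longlonglongrightarrow> 0" for y
  proof (rule LIMSEQ_I)
    fix e :: real assume e: "0 < e"
    \<comment> \<open>An open neighbourhood of \<open>y\<close> contains some \<open>D j\<close>;
      from stage \<open>j\<close> on, rounding does at least as well as \<open>D j\<close>.\<close>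
    have "open {z. r y z < e}"
      using r_cont(2)[of y] by (intro open_Collect_less continuous_intros)
    moreover have "y \<in> {z. r y z < e}" using e by (simp add: r_eq)
    ultimately obtain j where "r y (D j) < e" using C(2) D by blast
    then have "\<forall>i\<ge>j. norm (r y (D (p i y)) - 0) < e"
      using nearest_index_minimal[of j _ r y D] r_nonneg by (auto simp: p_def intro: le_less_trans)
    then show "\<exists>j. \<forall>i\<ge>j. norm (r y (D (p i y)) - 0) < e" ..
  qed
  have r_p_meas: "(\<lambda>y. r y (D (p i y))) \<in> borel_measurable Q" for i
    by (rule measurable_compose_countable[OF r_meas p_meas])
  show ?thesis
  proof (rule bochner_integral_in_exists[where s = s])
    show "simple_function Q (s i)" for i
      unfolding s_def by (rule simple_function_compose1[OF p_simple])
    have "(\<lambda>i. \<integral>\<^sup>+ y. ennreal (r y (D (p i y))) \<partial>Q) \<longlonglongrightarrow> (\<integral>\<^sup>+ y. 0 \<partial>Q)"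
    proof (rule nn_integral_dominated_convergence[where w = "\<lambda>_. ennreal (sqrt (4 * B))"])
      show "AE y in Q. (\<lambda>i. ennreal (r y (D (p i y)))) \<longlonglongrightarrow> 0"
        using tendsto_ennrealI[OF r_lim] by simp
      show "(\<integral>\<^sup>+ y. ennreal (sqrt (4 * B)) \<partial>Q) < \<infinity>"
        by (simp add: ennreal_mult_less_top emeasure_eq_measure)
    qed (use r_p_meas r_bound in \<open>auto intro!: AE_I2 ennreal_leI\<close>)
    then show "(\<lambda>i. \<integral>\<^sup>+ y. ennreal (hnorm ip (\<lambda>x. k x y - s i y x)) \<partial>Q) \<longlonglongrightarrow> 0"
      by (simp add: norm_eq)
    show "(\<lambda>y. hnorm ip (\<lambda>x. k x y - s i y x)) \<in> borel_measurable Q" for i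
      unfolding norm_eq by (rule r_p_meas)
  qed (use section_mem Q in \<open>auto simp: s_def\<close>)
qed

lemma integrable_bounded_continuous:
  fixes f :: "'a::topological_space \<Rightarrow> real"
  assumes "finite_measure Q" and sets: "sets Q = sets borel"
    and cont: "continuous_on UNIV f" and bound: "\<And>x. \<bar>f x\<bar> \<le> B"
  shows "integrable Q f"
proof -
  interpret finite_measure Q by fact
  have "f \<in> borel_measurable Q"
    using borel_measurable_continuous_onI[OF cont] sets measurable_cong_sets by blast
  then show ?thesis by (intro integrable_const_bound[where B = B]) (use bound in auto)
qed

lemma kernel_mean_embedding_eq:
  fixes k :: "'a::second_countable_topology \<Rightarrow> 'a \<Rightarrow> real"
  assumes rkhs: "rkhs k H ip"
    and bound: "\<And>x y. \<bar>k x y\<bar> \<le> B"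
    and cont: "continuous_on UNIV (\<lambda>(x, y). k x y)"
    and Q: "finite_measure Q" and sets: "sets Q = sets borel"
  shows "kernel_mean_embedding H ip k Q x = (\<integral>y. k x y \<partial>Q)"
proof -
  have int: "integrable Q (\<lambda>y. k x y)" for x
    using integrable_bounded_continuous[OF Q sets continuous_on_sections(1)[OF cont] bound] .
  have eval: "v = (\<lambda>x. \<integral>y. k x y \<partial>Q)" if "has_bochner_integral_in H ip Q (\<lambda>y x. k x y) v" for v
    using rkhs.has_bochner_integral_in_eval[OF rkhs Q that int] by (rule ext)
  obtain v where "has_bochner_integral_in H ip Q (\<lambda>y x. k x y) v"
    using bochner_integral_in_kernel_exists[OF rkhs bound cont Q sets] by blast
  then have "kernel_mean_embedding H ip k Q = v"
    unfolding kernel_mean_embedding_def using eval by (intro the_equality) auto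
  with eval[OF \<open>has_bochner_integral_in _ _ _ _ v\<close>] show ?thesis by simp
qed

section \<open>Weak convergence, uniformly over equicontinuous families\<close>

text \<open>Ranga Rao's theorem: weak convergence is uniform over bounded, pointwise equicontinuous
  families. On a set of \<^term>\<open>P\<close>-measure close to one, a finite partition of unity \<^term>\<open>w\<close>
  approximates all members of the family at once by combinations of the same finitely many
  continuous functions; the defect \<^term>\<open>h\<close> is itself bounded and continuous, so its integrals
  converge too and no tightness of the sequence is needed.\<close>

lemma uniform_limit_weak_conv_equicontinuous:
  fixes F :: "'b \<Rightarrow> 'a::{metric_space, second_countable_topology} \<Rightarrow> real"
  assumes P: "prob_space P" and P_sets: "sets P = sets borel"
    and Q: "\<And>n. prob_space (Q n)" and Q_sets: "\<And>n. sets (Q n) = sets borel"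
    and conv: "weak_conv_to Q P"
    and bound: "\<And>x y. \<bar>F x y\<bar> \<le> B"
    and equi: "\<And>y e. 0 < e \<Longrightarrow> \<exists>d>0. \<forall>z. dist z y < d \<longrightarrow> (\<forall>x. \<bar>F x z - F x y\<bar> < e)"
  shows "uniform_limit UNIV (\<lambda>n x. \<integral>y. F x y \<partial>Q n) (\<lambda>x. \<integral>y. F x y \<partial>P) sequentially"
proof (rule uniform_limitI)
  fix \<epsilon> :: real assume \<epsilon>: "0 < \<epsilon>"
  have B: "0 \<le> B" using bound order_trans[OF abs_ge_zero] by blast
  \<comment> \<open>The final budget: approximating the integrals against \<open>Q n\<close> and
    \<open>P\<close> costs \<open>e + B * e\<close> each, and comparing the two approximations costs
    \<open>B * e\<close>. Taking 3 where 2 would count the terms makes the total strictly less than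
    \<open>\<epsilon>\<close>.\<close>
  define e where "e = \<epsilon> / (3 + 3 * B)"
  have e: "0 < e" using \<epsilon> B by (simp add: e_def)
  have "2 * e + 3 * B * e < (3 + 3 * B) * e" using e by (simp add: algebra_simps)
  also have "\<dots> = \<epsilon>" using B by (simp add: e_def field_simps add_nonneg_eq_0_iff)
  finally have total: "2 * e + 3 * B * e < \<epsilon>" .
  interpret P: prob_space P by fact
  have F_cont: "continuous_on UNIV (F x)" for x
    unfolding continuous_on_iff dist_real_def using equi by (metis UNIV_I)
  \<comment> \<open>The radius is halved so that balls of radius \<open>r y\<close> cover the space
    while closeness holds on the doubled balls, which contain the supports of the weights up to
    their boundary.\<close>
  have "\<exists>d>0. \<forall>z. dist z y < 2 * d \<longrightarrow> (\<forall>x. \<bar>F x z - F x y\<bar> < e)" for y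
  proof -
    obtain d where "0 < d" "\<forall>z. dist z y < d \<longrightarrow> (\<forall>x. \<bar>F x z - F x y\<bar> < e)" using equi[OF e] by blast
    then show ?thesis by (intro exI[of _ "d / 2"]) auto
  qed
  then obtain r where r: "\<And>y. 0 < r y"
      and F_close: "\<And>x y z. dist z y < 2 * r y \<Longrightarrow> \<bar>F x z - F x y\<bar> < e"
    by metis
  obtain \<B> where \<B>: "\<B> \<subseteq> range (\<lambda>y. ball y (r y))" "countable \<B>"
      "\<Union>\<B> = \<Union>(range (\<lambda>y. ball y (r y)))"
    using Lindelof[of "range (\<lambda>y. ball y (r y))"] by auto
  obtain C where C: "countable C" "\<B> = (\<lambda>y. ball y (r y)) ` C"
    using \<B>(1,2) countable_subset_image[of \<B> "\<lambda>y. ball y (r y)" UNIV] by blast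
  have C_cover: "\<Union>((\<lambda>y. ball y (r y)) ` C) = UNIV"
    using \<B>(3) C(2) r by (auto intro: centre_in_ball[THEN iffD2])
  have "C \<noteq> {}" using C_cover by auto
  define c where "c = from_nat_into C"
  have c: "range c = C" unfolding c_def by (rule range_from_nat_into) fact+
  define A where "A n = (\<Union>j\<le>n. ball (c j) (r (c j)))" for n
  have A_sets: "A n \<in> sets P" for n
    unfolding A_def P_sets by (intro borel_open open_UN) auto
  have "incseq A" unfolding A_def incseq_def by (auto intro: order_trans)
  moreover have "(\<Union>n. A n) = UNIV" using C_cover c unfolding A_def by fastforce
  ultimately have "(\<lambda>n. measure P (A n)) \<longlonglongrightarrow> measure P UNIV"
    using P.finite_Lim_measure_incseq[of A] A_sets by auto
  moreover have "measure P UNIV = 1"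
    using P.prob_space sets_eq_imp_space_eq[OF P_sets] by simp
  ultimately have "\<forall>\<^sub>F n in sequentially. 1 - e < measure P (A n)"
    using e by (intro order_tendstoD(1)) auto
  then obtain N where N: "1 - e < measure P (A N)"
    by (auto dest: eventually_happens)

  \<comment> \<open>A tent that is at least 1 on the ball of radius \<open>r (c j)\<close> and
    vanishes at distance \<open>2 * r (c j)\<close> and beyond.\<close>
  define g where "g j y = max 0 (2 - dist y (c j) / r (c j))" for j y
  define G where "G y = (\<Sum>j\<le>N. g j y)" for y
  \<comment> \<open>Dividing by \<open>max 1 (G y)\<close> keeps the weights continuous where
    \<open>G\<close> vanishes, and still makes them sum to one wherever \<open>G\<close> is at least
    1, in particular on \<open>A N\<close>.\<close>
  define w where "w j y = g j y / max 1 (G y)" for j y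
  define h where "h y = 1 - (\<Sum>j\<le>N. w j y)" for y
  have g_nonneg: "0 \<le> g j y" for j y by (simp add: g_def)
  have G_nonneg: "0 \<le> G y" for y unfolding G_def by (intro sum_nonneg g_nonneg)
  have w_nonneg: "0 \<le> w j y" for j y by (simp add: w_def g_nonneg)
  have w_sum: "(\<Sum>j\<le>N. w j y) = G y / max 1 (G y)" for y
    by (simp add: w_def G_def sum_divide_distrib)
  have h_bounds: "0 \<le> h y" "h y \<le> 1" for y
    using G_nonneg[of y] unfolding h_def w_sum by (auto simp: divide_simps)
  have w_le: "\<bar>w j y\<bar> \<le> 1" if "j \<le> N" for j y
    using member_le_sum[of j "{..N}" "\<lambda>j. w j y"] that h_bounds(1)[of y] w_nonneg
    by (simp add: h_def)
  have h_A: "h y = 0" if "y \<in> A N" for y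
  proof -
    obtain j where j: "j \<le> N" "dist (c j) y < r (c j)" using \<open>y \<in> A N\<close> by (auto simp: A_def)
    then have "1 \<le> g j y" using r[of "c j"] by (simp add: g_def field_simps dist_commute)
    also have "\<dots> \<le> G y"
      using member_le_sum[of j "{..N}" "\<lambda>j. g j y"] j g_nonneg by (simp add: G_def)
    finally show ?thesis by (simp add: h_def w_sum)
  qed
  have g_cont: "continuous_on UNIV (g j)" for j
    unfolding g_def using r[of "c j"] by (intro continuous_intros) auto
  have w_cont: "continuous_on UNIV (w j)" for j
    unfolding w_def G_def using g_cont by (intro continuous_intros) auto
  have h_cont: "continuous_on UNIV h"
    unfolding h_def by (intro continuous_intros w_cont)
  have h_abs: "\<bar>h y\<bar> \<le> 1" for y using h_bounds[of y] by simp

  \<comment> \<open>Together with \<open>h y\<close> the weights sum to one, so \<open>F x y\<close>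
    splits accordingly: a weight is nonzero only where \<open>F x\<close> is within \<open>e\<close>
    of its value at the centre, and the defect term costs at most \<open>B * h y\<close>.\<close>
  have pointwise: "\<bar>F x y - (\<Sum>j\<le>N. w j y * F x (c j))\<bar> \<le> e + B * h y" for x y
  proof -
    have term_le: "w j y * \<bar>F x y - F x (c j)\<bar> \<le> w j y * e" for j
    proof (cases "dist y (c j) < 2 * r (c j)")
      case True
      then show ?thesis using F_close[of y "c j" x] w_nonneg[of j y] by (intro mult_left_mono) auto
    next
      case False
      then have "w j y = 0" using r[of "c j"] by (simp add: w_def g_def field_simps)
      then show ?thesis by simp
    qed
    have "F x y - (\<Sum>j\<le>N. w j y * F x (c j))
        = (\<Sum>j\<le>N. w j y * (F x y - F x (c j))) + h y * F x y"
      by (simp add: h_def algebra_simps sum_subtractf sum_distrib_left)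
    also have "\<bar>\<dots>\<bar> \<le> (\<Sum>j\<le>N. \<bar>w j y * (F x y - F x (c j))\<bar>) + \<bar>h y * F x y\<bar>"
      by (intro order_trans[OF abs_triangle_ineq] add_right_mono sum_abs)
    also have "(\<Sum>j\<le>N. \<bar>w j y * (F x y - F x (c j))\<bar>) \<le> (\<Sum>j\<le>N. w j y * e)"
      using term_le w_nonneg by (intro sum_mono) (simp add: abs_mult)
    also have "\<dots> = (1 - h y) * e" by (simp add: h_def sum_distrib_right)
    also have "\<dots> \<le> e" using e h_bounds[of y] by (simp add: algebra_simps)
    also have "\<bar>h y * F x y\<bar> \<le> B * h y"
      using mult_right_mono[OF bound[of x y] h_bounds(1)[of y]] h_bounds(1)[of y]
      by (simp add: abs_mult mult.commute)
    finally show ?thesis by simp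
  qed
  have integrated: "\<bar>(\<integral>y. F x y \<partial>R) - (\<Sum>j\<le>N. (\<integral>y. w j y \<partial>R) * F x (c j))\<bar> \<le> e + B * (\<integral>y. h y \<partial>R)"
    if R: "prob_space R" and R_sets: "sets R = sets borel" for R x
  proof -
    interpret R: prob_space R by fact
    note int = integrable_bounded_continuous[OF R.finite_measure_axioms R_sets]
    have int': "integrable R (F x)" "integrable R h" "\<And>j. j \<in> {..N} \<Longrightarrow> integrable R (w j)"
      using int[OF F_cont bound] int[OF h_cont h_abs] int[OF w_cont w_le] by auto
    have int_sum: "integrable R (\<lambda>y. \<Sum>j\<le>N. w j y * F x (c j))"
      using int' by (intro Bochner_Integration.integrable_sum) simp
    have sum_eq: "(\<integral>y. (\<Sum>j\<le>N. w j y * F x (c j)) \<partial>R) = (\<Sum>j\<le>N. (\<integral>y. w j y \<partial>R) * F x (c j))"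
      using int' by (subst Bochner_Integration.integral_sum) auto
    have "(\<integral>y. F x y \<partial>R) - (\<Sum>j\<le>N. (\<integral>y. w j y \<partial>R) * F x (c j))
        = (\<integral>y. F x y - (\<Sum>j\<le>N. w j y * F x (c j)) \<partial>R)"
      using int' int_sum by (simp add: sum_eq)
    also have "\<bar>\<dots>\<bar> \<le> (\<integral>y. \<bar>F x y - (\<Sum>j\<le>N. w j y * F x (c j))\<bar> \<partial>R)"
      by (rule integral_abs_bound)
    also have "\<dots> \<le> (\<integral>y. e + B * h y \<partial>R)"
      using int' int_sum pointwise by (intro integral_mono) auto
    also have "\<dots> = e + B * (\<integral>y. h y \<partial>R)"
      using int' R.prob_space by simp
    finally show ?thesis .
  qed
  have weak: "(\<lambda>n. \<integral>y. f y \<partial>Q n) \<longlonglongrightarrow> (\<integral>y. f y \<partial>P)"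
    if "continuous_on UNIV f" "\<And>y. \<bar>f y\<bar> \<le> 1" for f :: "'a \<Rightarrow> real"
  proof -
    have "bounded (range f)" using that(2) by (auto intro!: boundedI[where B = 1])
    with conv that(1) show ?thesis by (simp add: weak_conv_to_def)
  qed
  \<comment> \<open>The defect vanishes on \<open>A N\<close> and is at most 1 elsewhere, so its
    integral is bounded by the mass outside \<open>A N\<close>.\<close>
  have h_P: "(\<integral>y. h y \<partial>P) < e"
  proof -
    have int_A: "integrable P (indicator (A N) :: 'a \<Rightarrow> real)"
      using A_sets by (intro integrable_real_indicator) (auto simp: P.emeasure_eq_measure)
    have "(\<integral>y. h y \<partial>P) \<le> (\<integral>y. 1 - indicator (A N) y \<partial>P)"
    proof (rule integral_mono)
      show "h y \<le> 1 - indicator (A N) y" for y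
        using h_A h_bounds by (auto simp: indicator_def)
    qed (use integrable_bounded_continuous[OF P.finite_measure_axioms P_sets h_cont h_abs] int_A
        in auto)
    also have "\<dots> = 1 - measure P (A N)"
      using int_A P.prob_space sets.sets_into_space[OF A_sets]
      by (subst Bochner_Integration.integral_diff) (auto simp: Int_absorb2)
    finally show ?thesis using N by simp
  qed
  have "\<forall>\<^sub>F n in sequentially. (\<integral>y. h y \<partial>Q n) < e"
    using order_tendstoD(2)[OF weak[OF h_cont h_abs] h_P] .
  moreover have "(\<lambda>n. \<Sum>j\<le>N. \<bar>(\<integral>y. w j y \<partial>Q n) - (\<integral>y. w j y \<partial>P)\<bar>) \<longlonglongrightarrow> (\<Sum>j\<le>N. 0)"
    by (intro tendsto_sum tendsto_rabs_zero LIM_zero weak w_cont w_le) auto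
  then have "\<forall>\<^sub>F n in sequentially. (\<Sum>j\<le>N. \<bar>(\<integral>y. w j y \<partial>Q n) - (\<integral>y. w j y \<partial>P)\<bar>) < e"
    using e by (intro order_tendstoD(2)) auto
  ultimately show "\<forall>\<^sub>F n in sequentially. \<forall>x\<in>UNIV.
      dist (\<integral>y. F x y \<partial>Q n) (\<integral>y. F x y \<partial>P) < \<epsilon>"
  proof eventually_elim
    case (elim n)
    show ?case
    proof
      fix x
      let ?S = "\<lambda>R. \<Sum>j\<le>N. (\<integral>y. w j y \<partial>R) * F x (c j)"
      \<comment> \<open>The measure enters \<open>?S\<close> through finitely many numbers and x
        only through coefficients bounded by B; hence the uniformity in x.\<close>
      have "\<bar>?S (Q n) - ?S P\<bar> = \<bar>\<Sum>j\<le>N. ((\<integral>y. w j y \<partial>Q n) - (\<integral>y. w j y \<partial>P)) * F x (c j)\<bar>"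
        by (simp add: sum_subtractf left_diff_distrib)
      also have "\<dots> \<le> (\<Sum>j\<le>N. \<bar>(\<integral>y. w j y \<partial>Q n) - (\<integral>y. w j y \<partial>P)\<bar> * B)"
        using bound by (intro order_trans[OF sum_abs] sum_mono) (simp add: abs_mult mult_left_mono)
      also have "\<dots> \<le> e * B"
        using elim(2) B unfolding sum_distrib_right[symmetric] by (intro mult_right_mono) auto
      finally have "\<bar>?S (Q n) - ?S P\<bar> \<le> B * e" by (simp add: mult.commute)
      moreover have "\<bar>(\<integral>y. F x y \<partial>Q n) - ?S (Q n)\<bar> \<le> e + B * e"
        using integrated[OF Q[of n] Q_sets[of n], of x] mult_left_mono[OF less_imp_le[OF elim(1)] B] by linarith
      moreover have "\<bar>(\<integral>y. F x y \<partial>P) - ?S P\<bar> \<le> e + B * e"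
        using integrated[OF P P_sets, of x] mult_left_mono[OF less_imp_le[OF h_P] B] by linarith
      ultimately show "dist (\<integral>y. F x y \<partial>Q n) (\<integral>y. F x y \<partial>P) < \<epsilon>"
        using total unfolding dist_real_def by linarith
    qed
  qed
qed

text \<open>The reproducing property bounds \<^term>\<open>k x z - k x y\<close> by the distance of the sections at
  \<^term>\<open>z\<close> and \<^term>\<open>y\<close> in the RKHS, uniformly in \<^term>\<open>x\<close>.\<close>

lemma kernel_equicontinuous:
  fixes k :: "'a::metric_space \<Rightarrow> 'a \<Rightarrow> real"
  assumes rkhs: "rkhs k H ip"
    and bound: "\<And>x y. \<bar>k x y\<bar> \<le> B"
    and cont: "continuous_on UNIV (\<lambda>(x, y). k x y)"
    and e: "0 < e"
  shows "\<exists>d>0. \<forall>z. dist z y < d \<longrightarrow> (\<forall>x. \<bar>k x z - k x y\<bar> < e)"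
proof -
  interpret rkhs k H ip by fact
  \<comment> \<open>Replacing \<open>k x x\<close> by its bound B removes x. As \<open>?u\<close>
    vanishes at \<open>y\<close>, its continuity there yields a \<open>d\<close> valid for all
    x.\<close>
  let ?u = "\<lambda>z. sqrt B * sqrt (k z z - 2 * k y z + k y y)"
  have "continuous_on UNIV ?u" by (intro continuous_intros continuous_on_sections[OF cont])
  then obtain d where d: "0 < d" "\<And>z. dist z y < d \<Longrightarrow> dist (?u z) (?u y) < e"
    using e unfolding continuous_on_iff by blast
  have le: "\<bar>k x z - k x y\<bar> \<le> ?u z" for x z
  proof -
    have "\<bar>k x z - k x y\<bar> \<le> sqrt (k x x) * hnorm ip (\<lambda>x. k x z - k x y)"
      by (rule abs_eval_le) (intro diff_mem section_mem)
    also have "\<dots> \<le> sqrt B * hnorm ip (\<lambda>x. k x z - k x y)"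
      using bound[of x x] by (intro mult_right_mono hnorm_nonneg diff_mem section_mem) auto
    finally show ?thesis by (simp add: hnorm_section_diff)
  qed
  have "\<bar>k x z - k x y\<bar> < e" if "dist z y < d" for x z
    using d(2)[OF that] le[of x z] by (simp add: dist_real_def)
  with d(1) show ?thesis by blast
qed

section \<open>Empirical measures and the supremum\<close>

lemma prob_space_empirical_measure:
  assumes "0 < n"
  shows "prob_space (empirical_measure n x)"
proof (rule prob_spaceI)
  have "emeasure (empirical_measure n x) UNIV = of_nat n / of_nat n"
    by (subst emeasure_empirical_measure) (auto simp: sum.cong)
  also have "\<dots> = 1" using assms by (intro ennreal_divide_self) (auto simp: of_nat_less_top)
  finally show "emeasure (empirical_measure n x) (space (empirical_measure n x)) = 1" by simp
qed

lemma uniform_limit_imp_SUP_tendsto_0: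
  fixes f :: "nat \<Rightarrow> 'a \<Rightarrow> real"
  assumes "uniform_limit UNIV f l sequentially"
  shows "(\<lambda>n. SUP x. \<bar>f n x - l x\<bar>) \<longlonglongrightarrow> 0"
proof (rule tendstoI)
  fix e :: real assume e: "0 < e"
  \<comment> \<open>Half of \<open>e\<close>, since a supremum may reach a bound that every value
    stays strictly below.\<close>
  then have "\<forall>\<^sub>F n in sequentially. \<forall>x\<in>UNIV. dist (f n x) (l x) < e / 2"
    using uniform_limitD[OF assms, of "e / 2"] by simp
  then show "\<forall>\<^sub>F n in sequentially. dist (SUP x. \<bar>f n x - l x\<bar>) 0 < e"
  proof eventually_elim
    case (elim n)
    then have le: "\<bar>f n x - l x\<bar> \<le> e / 2" for x by (simp add: dist_real_def less_imp_le)
    have "(SUP x. \<bar>f n x - l x\<bar>) \<le> e / 2" using le by (intro cSUP_least) auto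
    \<comment> \<open>A real supremum dominates its members only when the family is bounded above;
      \<open>e / 2\<close> is such a bound.\<close>
    moreover have "0 \<le> (SUP x. \<bar>f n x - l x\<bar>)"
      using le by (intro cSUP_upper2[where x = undefined]) (auto intro!: bdd_aboveI2[where M = "e / 2"])
    ultimately show ?case using e by (simp add: dist_real_def)
  qed
qed

theorem theorem8:
  fixes k :: "'a::{metric_space, second_countable_topology} \<Rightarrow> 'a \<Rightarrow> real"
    and H :: "('a \<Rightarrow> real) set"
    and ip :: "('a \<Rightarrow> real) \<Rightarrow> ('a \<Rightarrow> real) \<Rightarrow> real"
    and P :: "'a measure"
    and M :: "'w measure"
    and X :: "nat \<Rightarrow> 'w \<Rightarrow> 'a"
    and Xt :: "nat \<Rightarrow> nat \<Rightarrow> 'w \<Rightarrow> 'a"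
  assumes "pd_kernel k"
    and "bounded (range (\<lambda>(x, y). k x y))"
    and "continuous_on UNIV (\<lambda>(x, y). k x y)"
    and "rkhs k H ip"
    and "prob_space P" and "sets P = sets borel"
    and "prob_space M"
    and "prob_space.indep_vars M (\<lambda>i. borel) X {1..}"
    and "\<And>i. 1 \<le> i \<Longrightarrow> distr M borel (X i) = P"
    and "\<And>n i. 1 \<le> i \<Longrightarrow> i \<le> n \<Longrightarrow> Xt n i \<in> borel_measurable M"
    and "AE \<omega> in M. weak_conv_to (\<lambda>n. empirical_measure n (\<lambda>i. Xt n i \<omega>)) P"
  shows "AE \<omega> in M.
    (\<lambda>n. SUP x. \<bar>kernel_mean_embedding H ip k (empirical_measure n (\<lambda>i. Xt n i \<omega>)) x
                - kernel_mean_embedding H ip k P x\<bar>) \<longlonglongrightarrow> 0"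
proof -
  obtain B where B: "\<And>x y. \<bar>k x y\<bar> \<le> B"
    using assms(2) by (auto simp: bounded_iff)
  interpret P: prob_space P by fact
  note embedding = kernel_mean_embedding_eq[OF assms(4) B assms(3)]
  have "(\<lambda>n. SUP x. \<bar>kernel_mean_embedding H ip k (empirical_measure n (\<lambda>i. Xt n i \<omega>)) x
      - kernel_mean_embedding H ip k P x\<bar>) \<longlonglongrightarrow> 0"
    if conv: "weak_conv_to (\<lambda>n. empirical_measure n (\<lambda>i. Xt n i \<omega>)) P" for \<omega>
  proof -
    \<comment> \<open>At index 0 the empirical measure is the null measure, not a probability
      measure. The sequence therefore starts at 1, a shift that changes no limit.\<close>
    define Q where "Q n = empirical_measure (Suc n) (\<lambda>i. Xt (Suc n) i \<omega>)" for n
    have Q: "prob_space (Q n)" "sets (Q n) = sets borel" for n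
      by (auto simp: Q_def prob_space_empirical_measure)
    have "weak_conv_to Q P"
      unfolding weak_conv_to_def
    proof (intro allI impI)
      fix f :: "'a \<Rightarrow> real"
      assume "continuous_on UNIV f" "bounded (range f)"
      with conv have "(\<lambda>n. \<integral>x. f x \<partial>empirical_measure n (\<lambda>i. Xt n i \<omega>)) \<longlonglongrightarrow> (\<integral>x. f x \<partial>P)"
        by (simp add: weak_conv_to_def)
      then show "(\<lambda>n. \<integral>x. f x \<partial>Q n) \<longlonglongrightarrow> (\<integral>x. f x \<partial>P)"
        unfolding Q_def by (rule LIMSEQ_Suc)
    qed
    then have "uniform_limit UNIV (\<lambda>n x. \<integral>y. k x y \<partial>Q n) (\<lambda>x. \<integral>y. k x y \<partial>P) sequentially"
      by (intro uniform_limit_weak_conv_equicontinuous[OF assms(5,6) Q _ B]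
          kernel_equicontinuous[OF assms(4) B assms(3)])
    then have "(\<lambda>n. SUP x. \<bar>(\<integral>y. k x y \<partial>Q n) - (\<integral>y. k x y \<partial>P)\<bar>) \<longlonglongrightarrow> 0"
      by (rule uniform_limit_imp_SUP_tendsto_0)
    then have "(\<lambda>n. SUP x. \<bar>kernel_mean_embedding H ip k (Q n) x
        - kernel_mean_embedding H ip k P x\<bar>) \<longlonglongrightarrow> 0"
      by (simp add: embedding[OF P.finite_measure_axioms assms(6)]
          embedding[OF prob_space.finite_measure[OF Q(1)] Q(2)])
    then show ?thesis unfolding Q_def by (rule LIMSEQ_imp_Suc)
  qed
  with assms(11) show ?thesis by auto
qed

end
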